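(* Let $\beta>1$ and let $k\ge0$ be an integer. For any blocks $a_1\ldots a_{k+1},\,b_1\ldots b_{k+1}\in\{0,1,\ldots,\lfloor\beta\rfloor+1\}^{k+1}$, the function $M_\beta$ is linear on $I_\beta(a_1\ldots a_{k+1},b_1\ldots b_{k+1})$; that is, there are real numbers $c,d$ such that $M_\beta(\alpha)=c\alpha+d$ for all $\alpha\in I_\beta(a_1\ldots a_{k+1},b_1\ldots b_{k+1})$.
   Context: $\lfloor\cdot\rfloor$ denotes the integer part and $\lambda$ Lebesgue measure. For $\beta>1$ and $\alpha\in[0,1)$, let $T_{\beta,\alpha}:[0,1]\to[0,1]$, $T_{\beta,\alpha}(x)=\beta x+\alpha-\lfloor\beta x+\alpha\rfloor$, with iterates $T_{\beta,\alpha}^n$ ($T_{\beta,\alpha}^0$ the identity). $T_{\beta,\alpha}$ has matching at time $k$ if $k$ is the smallest positive integer with $T_{\beta,\alpha}^k(0)=T_{\beta,\alpha}^k(1)$. For an integer $i\ge0$ let $\Delta(i)=\{x\in[0,1]:\lfloor\beta x+\alpha\rfloor=i\}$ (depending on $\beta,\alpha$). The matching interval associated with $(a_1\ldots a_{k+1},b_1\ldots b_{k+1})$ is $$I_\beta(a_1\ldots a_{k+1},b_1\ldots b_{k+1})=\{\alpha\in[0,1):\ T_{\beta,\alpha}\text{ has matching at time }k+1,\ T_{\beta,\alpha}^{i-1}(0)\in\Delta(a_i)\text{ and }T_{\beta,\alpha}^{i-1}(1)\in\Delta(b_i)\ \text{for all }1\le i\le k+1\}.$$ Define, for $x\in[0,1]$,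 $$\tilde g_{\beta,\alpha}(x)=\sum_{n\ge 0:\ x<T_{\beta,\alpha}^n(1)}\frac{1}{\beta^n}-\sum_{n\ge 0:\ x<T_{\beta,\alpha}^n(0)}\frac{1}{\beta^n},\qquad g_{\beta,\alpha}(x)=\frac{\tilde g_{\beta,\alpha}(x)}{\int_{[0,1]}\tilde g_{\beta,\alpha}\,d\lambda},$$ and $M_\beta(\alpha)=\int_{[0,1]}x\,g_{\beta,\alpha}(x)\,d\lambda(x)$. *)

theory Defs
  imports "HOL-Analysis.Analysis"
begin

text \<open>Generalised \<open>\<beta>\<close>-transformations are used for \<open>\<beta> > 1\<close> and \<open>\<alpha> \<in> [0,1)\<close>. The map is given
  on all reals; it sends \<open>[0,1]\<close> into itself, and only orbits of points of \<open>[0,1]\<close> occur.\<close>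

definition T :: "real \<Rightarrow> real \<Rightarrow> real \<Rightarrow> real" where
  "T \<beta> \<alpha> x = \<beta> * x + \<alpha> - of_int \<lfloor>\<beta> * x + \<alpha>\<rfloor>"

definition has_matching_at :: "real \<Rightarrow> real \<Rightarrow> nat \<Rightarrow> bool" where
  "has_matching_at \<beta> \<alpha> k \<longleftrightarrow>
     0 < k \<and> (T \<beta> \<alpha> ^^ k) 0 = (T \<beta> \<alpha> ^^ k) 1 \<and>
     (\<forall>j. 0 < j \<and> j < k \<longrightarrow> (T \<beta> \<alpha> ^^ j) 0 \<noteq> (T \<beta> \<alpha> ^^ j) 1)"

definition Delta :: "real \<Rightarrow> real \<Rightarrow> nat \<Rightarrow> real set" where
  "Delta \<beta> \<alpha> i = {x \<in> {0..1}. \<lfloor>\<beta> * x + \<alpha>\<rfloor> = int i}"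

text \<open>Blocks are lists of a common length \<open>k + 1\<close>; list indices start at \<open>0\<close>, so \<open>as ! i\<close> is the
  digit \<open>a\<^sub>i\<^sub>+\<^sub>1\<close>, to be compared with the \<open>i\<close>-th iterate.\<close>

definition matching_interval :: "real \<Rightarrow> nat list \<Rightarrow> nat list \<Rightarrow> real set" where
  "matching_interval \<beta> as bs =
     {\<alpha> \<in> {0..<1}. has_matching_at \<beta> \<alpha> (length as) \<and>
        (\<forall>i<length as. (T \<beta> \<alpha> ^^ i) 0 \<in> Delta \<beta> \<alpha> (as ! i) \<and>
                       (T \<beta> \<alpha> ^^ i) 1 \<in> Delta \<beta> \<alpha> (bs ! i))}"

definition g_tilde :: "real \<Rightarrow> real \<Rightarrow> real \<Rightarrow> real" where
  "g_tilde \<beta> \<alpha> x =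
     (\<Sum>\<^sub>\<infinity>n\<in>{n. x < (T \<beta> \<alpha> ^^ n) 1}. 1 / \<beta> ^ n) - (\<Sum>\<^sub>\<infinity>n\<in>{n. x < (T \<beta> \<alpha> ^^ n) 0}. 1 / \<beta> ^ n)"

definition g :: "real \<Rightarrow> real \<Rightarrow> real \<Rightarrow> real" where
  "g \<beta> \<alpha> x = g_tilde \<beta> \<alpha> x / (LINT y:{0..1}|lborel. g_tilde \<beta> \<alpha> y)"

definition M :: "real \<Rightarrow> real \<Rightarrow> real" where
  "M \<beta> \<alpha> = (LINT x:{0..1}|lborel. x * g \<beta> \<alpha> x)"

end

theory Submission
  imports Defs
begin

text \<open>Matching makes the two orbits coincide from time \<open>m = k + 1\<close> on, so in the series for
  \<open>g_tilde\<close> the tails cancel and a finite sum of step functions remains. Its moments on the unit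
  interval are therefore explicit: with \<open>p\<^sub>n\<close> and \<open>q\<^sub>n\<close> the \<open>n\<close>-th iterates of \<open>0\<close> and \<open>1\<close>,
  \<open>\<integral> g_tilde = \<Sum>n<m. (q\<^sub>n - p\<^sub>n) / \<beta>^n\<close> and
  \<open>\<integral> x * g_tilde = \<Sum>n<m. (q\<^sub>n\<^sup>2 - p\<^sub>n\<^sup>2) / (2 * \<beta>^n)\<close> (lemma \<open>moment_g_tilde\<close>).

  Once the digits are prescribed, \<open>p\<^sub>n\<close> and \<open>q\<^sub>n\<close> are affine in \<open>\<alpha>\<close> with the \<^emph>\<open>same\<close> slope
  \<open>1 + \<beta> + \<dots> + \<beta>^(n-1)\<close>, because each application of the map multiplies the slope by \<open>\<beta>\<close> and adds
  \<open>1\<close> (lemma \<open>orbit_affine\<close>). Hence \<open>q\<^sub>n - p\<^sub>n\<close> is constant: the total mass does not depend on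
  \<open>\<alpha>\<close>, and in the first moment \<open>q\<^sub>n\<^sup>2 - p\<^sub>n\<^sup>2 = (q\<^sub>n - p\<^sub>n) * (q\<^sub>n + p\<^sub>n)\<close> is a constant times an
  affine function. Their quotient \<open>M\<close> is affine in \<open>\<alpha>\<close>; should the total mass vanish, it vanishes for
  all \<open>\<alpha>\<close> at once, and \<open>M\<close> is \<open>0\<close> because division by zero yields \<open>0\<close>.\<close>

text \<open>The base-\<open>\<beta>\<close> number \<open>\<Sum>i<n. \<beta>^(n-1-i) * ds!i\<close>, written as the Horner scheme that the iteration
  of the map produces.\<close>

primrec digit_value :: "real \<Rightarrow> nat list \<Rightarrow> nat \<Rightarrow> real" where
  "digit_value \<beta> ds 0 = 0"
| "digit_value \<beta> ds (Suc n) = \<beta> * digit_value \<beta> ds n + real (ds ! n)"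

text \<open>As long as the digits are known, one step of the map is \<open>y \<mapsto> \<beta> * y + \<alpha> - d\<close>. The
  point is that the coefficient of \<open>\<alpha>\<close> depends neither on the starting point nor on the digits.\<close>

lemma orbit_affine:
  assumes "\<And>i. i < n \<Longrightarrow> (T \<beta> \<alpha> ^^ i) x \<in> Delta \<beta> \<alpha> (ds ! i)"
  shows "(T \<beta> \<alpha> ^^ n) x = \<beta> ^ n * x + \<alpha> * (\<Sum>i<n. \<beta> ^ i) - digit_value \<beta> ds n"
  using assms
proof (induction n)
  case 0
  then show ?case by simp
next
  case (Suc n)
  let ?y = "(T \<beta> \<alpha> ^^ n) x"
  have IH: "?y = \<beta> ^ n * x + \<alpha> * (\<Sum>i<n. \<beta> ^ i) - digit_value \<beta> ds n"
    by (rule Suc.IH) (use Suc.prems in simp)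
  have "\<lfloor>\<beta> * ?y + \<alpha>\<rfloor> = int (ds ! n)"
    using Suc.prems[of n] by (simp add: Delta_def)
  then have step: "(T \<beta> \<alpha> ^^ Suc n) x = \<beta> * ?y + \<alpha> - real (ds ! n)"
    by (simp add: T_def)
  have slope: "(\<Sum>i<Suc n. \<beta> ^ i) = \<beta> * (\<Sum>i<n. \<beta> ^ i) + 1"
    by (subst sum.lessThan_Suc_shift) (simp add: sum_distrib_left)
  show ?case
    unfolding step slope IH by (simp add: algebra_simps)
qed

lemma iterates_agree_after_matching:
  fixes f :: "'a \<Rightarrow> 'a"
  assumes "(f ^^ m) x = (f ^^ m) y" "m \<le> n"
  shows "(f ^^ n) x = (f ^^ n) y"
proof -
  obtain j where "n = j + m"
    using assms(2) by (metis le_add_diff_inverse2)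
  then show ?thesis
    using assms(1) by (simp add: funpow_add)
qed

text \<open>From time \<open>m\<close> on both series run over the same indices. Their common tail may be subtracted
  because geometric series converge.\<close>

lemma g_tilde_matching:
  assumes \<beta>: "\<beta> > 1"
    and match: "(T \<beta> \<alpha> ^^ m) 0 = (T \<beta> \<alpha> ^^ m) 1"
  shows "g_tilde \<beta> \<alpha> x =
    (\<Sum>n<m. (indicator {..<(T \<beta> \<alpha> ^^ n) 1} x - indicator {..<(T \<beta> \<alpha> ^^ n) 0} x) / \<beta> ^ n)"
proof -
  have summable: "(\<lambda>n. 1 / \<beta> ^ n) summable_on A" for A :: "nat set"
  proof -
    have "summable (\<lambda>n. norm (1 / \<beta> ^ n))"
      using summable_geometric[of "1 / \<beta>"] \<beta> by (simp add: power_one_over)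
    then have "(\<lambda>n. 1 / \<beta> ^ n) summable_on UNIV"
      by (rule norm_summable_imp_summable_on)
    then show ?thesis
      by (rule summable_on_subset_banach) simp
  qed
  let ?A = "\<lambda>z. {n. x < (T \<beta> \<alpha> ^^ n) z}"
  have split: "(\<Sum>\<^sub>\<infinity>n\<in>?A z. 1 / \<beta> ^ n) =
      (\<Sum>n<m. indicator {..<(T \<beta> \<alpha> ^^ n) z} x / \<beta> ^ n) + (\<Sum>\<^sub>\<infinity>n\<in>?A z \<inter> {m..}. 1 / \<beta> ^ n)" for z
  proof -
    have "?A z = (?A z \<inter> {..<m}) \<union> (?A z \<inter> {m..})"
      by auto
    then have "(\<Sum>\<^sub>\<infinity>n\<in>?A z. 1 / \<beta> ^ n) =
        (\<Sum>\<^sub>\<infinity>n\<in>(?A z \<inter> {..<m}) \<union> (?A z \<inter> {m..}). 1 / \<beta> ^ n)"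
      by simp
    also have "\<dots> = (\<Sum>\<^sub>\<infinity>n\<in>?A z \<inter> {..<m}. 1 / \<beta> ^ n) + (\<Sum>\<^sub>\<infinity>n\<in>?A z \<inter> {m..}. 1 / \<beta> ^ n)"
      by (rule infsum_Un_disjoint) (auto intro: summable)
    also have "(\<Sum>\<^sub>\<infinity>n\<in>?A z \<inter> {..<m}. 1 / \<beta> ^ n) = (\<Sum>n\<in>?A z \<inter> {..<m}. 1 / \<beta> ^ n)"
      by simp
    also have "\<dots> = (\<Sum>n<m. indicator {..<(T \<beta> \<alpha> ^^ n) z} x / \<beta> ^ n)"
      by (rule sum.mono_neutral_cong_left) (auto simp: indicator_def)
    finally show ?thesis .
  qed
  have "(T \<beta> \<alpha> ^^ n) 0 = (T \<beta> \<alpha> ^^ n) 1" if "n \<ge> m" for n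
    using match that by (rule iterates_agree_after_matching)
  then have tails: "?A 1 \<inter> {m..} = ?A 0 \<inter> {m..}"
    by auto
  show ?thesis
    unfolding g_tilde_def split tails by (simp add: sum_subtractf diff_divide_distrib)
qed

lemma moment_step:
  fixes q :: real
  assumes "q \<in> {0..1}"
  shows "has_bochner_integral lborel
    (\<lambda>x. indicator {0..1} x * (x ^ j * indicator {..<q} x)) (q ^ Suc j / real (Suc j))"
proof -
  have "has_bochner_integral lborel (\<lambda>x. x ^ j * indicator {0..q} x)
      ((q ^ Suc j - 0 ^ Suc j) / real (Suc j))"
    unfolding diff_divide_distrib
  proof (rule has_bochner_integral_FTC_Icc_real)
    show "((\<lambda>x. x ^ Suc j / real (Suc j)) has_real_derivative x ^ j) (at x)" for x :: real
      by (intro derivative_eq_intros) auto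
  qed (use assms in auto)
  \<comment> \<open>The two integrands differ at most at the endpoint \<open>q\<close>.\<close>
  moreover have "AE x in lborel. x ^ j * indicator {0..q} x =
      indicator {0..1} x * (x ^ j * indicator {..<q} x)"
    using AE_lborel_singleton[of q]
    by eventually_elim (use assms in \<open>auto simp: indicator_def\<close>)
  ultimately show ?thesis
    by (subst has_bochner_integral_cong_AE[symmetric]) auto
qed

lemma moment_g_tilde:
  assumes \<beta>: "\<beta> > 1"
    and match: "(T \<beta> \<alpha> ^^ m) 0 = (T \<beta> \<alpha> ^^ m) 1"
    and unit: "\<And>n. n < m \<Longrightarrow> (T \<beta> \<alpha> ^^ n) 0 \<in> {0..1}" "\<And>n. n < m \<Longrightarrow> (T \<beta> \<alpha> ^^ n) 1 \<in> {0..1}"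
  shows "(LINT x:{0..1}|lborel. x ^ j * g_tilde \<beta> \<alpha> x) =
    (\<Sum>n<m. ((T \<beta> \<alpha> ^^ n) 1 ^ Suc j - (T \<beta> \<alpha> ^^ n) 0 ^ Suc j) / (real (Suc j) * \<beta> ^ n))"
proof -
  let ?h = "\<lambda>z n x. indicator {0..1} x * (x ^ j * indicator {..<(T \<beta> \<alpha> ^^ n) z} x) :: real"
  have "has_bochner_integral lborel (\<lambda>x. \<Sum>n<m. (?h 1 n x - ?h 0 n x) / \<beta> ^ n)
      (\<Sum>n<m. ((T \<beta> \<alpha> ^^ n) 1 ^ Suc j / real (Suc j) - (T \<beta> \<alpha> ^^ n) 0 ^ Suc j / real (Suc j)) / \<beta> ^ n)"
    using unit
    by (intro has_bochner_integral_sum has_bochner_integral_divide_zero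
        has_bochner_integral_diff moment_step) auto
  moreover have "(\<lambda>x. \<Sum>n<m. (?h 1 n x - ?h 0 n x) / \<beta> ^ n) =
      (\<lambda>x. indicator {0..1} x *\<^sub>R (x ^ j * g_tilde \<beta> \<alpha> x))"
    unfolding g_tilde_matching[OF \<beta> match]
    by (simp add: sum_distrib_left algebra_simps)
  ultimately show ?thesis
    unfolding set_lebesgue_integral_def
    by (simp add: has_bochner_integral_integral_eq diff_divide_distrib)
qed

theorem lemma3p4:
  fixes \<beta> :: real and k :: nat and as bs :: "nat list"
  assumes "\<beta> > 1"
    and "length as = k + 1" and "set as \<subseteq> {0..nat \<lfloor>\<beta>\<rfloor> + 1}"
    and "length bs = k + 1" and "set bs \<subseteq> {0..nat \<lfloor>\<beta>\<rfloor> + 1}"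
  shows "\<exists>c d :: real. \<forall>\<alpha> \<in> matching_interval \<beta> as bs. M \<beta> \<alpha> = c * \<alpha> + d"
proof -
  \<comment> \<open>The gap is \<open>q\<^sub>n - p\<^sub>n\<close>; the sum \<open>q\<^sub>n + p\<^sub>n\<close> is \<open>2 * slope n * \<alpha> + off n\<close>.\<close>
  define m where "m = length as"
  define gap where "gap n = \<beta> ^ n + digit_value \<beta> as n - digit_value \<beta> bs n" for n
  define off where "off n = \<beta> ^ n - digit_value \<beta> as n - digit_value \<beta> bs n" for n
  define slope where "slope n = (\<Sum>i<n. \<beta> ^ i)" for n
  define mass where "mass = (\<Sum>n<m. gap n / \<beta> ^ n)"
  define c where "c = (\<Sum>n<m. gap n * slope n / \<beta> ^ n) / mass"
  define d where "d = (\<Sum>n<m. gap n * off n / (2 * \<beta> ^ n)) / mass"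
  have "M \<beta> \<alpha> = c * \<alpha> + d" if \<alpha>: "\<alpha> \<in> matching_interval \<beta> as bs" for \<alpha>
  proof -
    let ?p = "\<lambda>n. (T \<beta> \<alpha> ^^ n) 0" and ?q = "\<lambda>n. (T \<beta> \<alpha> ^^ n) 1"
    have match: "?p m = ?q m"
      using \<alpha> by (simp add: matching_interval_def has_matching_at_def m_def)
    have digits: "?p n \<in> Delta \<beta> \<alpha> (as ! n)" "?q n \<in> Delta \<beta> \<alpha> (bs ! n)" if "n < m" for n
      using \<alpha> that by (auto simp: matching_interval_def m_def)
    have unit: "?p n \<in> {0..1}" "?q n \<in> {0..1}" if "n < m" for n
      using digits[OF that] by (auto simp: Delta_def)
    have p: "?p n = \<alpha> * slope n - digit_value \<beta> as n"
      and q: "?q n = \<beta> ^ n + \<alpha> * slope n - digit_value \<beta> bs n" if "n < m" for n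
      using orbit_affine[of n \<beta> \<alpha> 0 as] orbit_affine[of n \<beta> \<alpha> 1 bs] digits that
      by (simp_all add: slope_def)
    note moment = moment_g_tilde[OF \<open>\<beta> > 1\<close> match unit]
    have mass: "(LINT x:{0..1}|lborel. g_tilde \<beta> \<alpha> x) = mass"
      using moment[of 0] by (simp add: mass_def gap_def p q algebra_simps cong: sum.cong_simp)
    have "(LINT x:{0..1}|lborel. x * g_tilde \<beta> \<alpha> x) = (\<Sum>n<m. (?q n ^ 2 - ?p n ^ 2) / (2 * \<beta> ^ n))"
      using moment[of 1] by (simp add: numeral_2_eq_2)
    also have "\<dots> = (\<Sum>n<m. gap n * slope n / \<beta> ^ n * \<alpha> + gap n * off n / (2 * \<beta> ^ n))"
    proof (rule sum.cong)
      fix n assume "n \<in> {..<m}"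
      then have "?q n ^ 2 - ?p n ^ 2 = gap n * (2 * slope n * \<alpha> + off n)"
        by (simp add: p q gap_def off_def power2_eq_square algebra_simps)
      then show "(?q n ^ 2 - ?p n ^ 2) / (2 * \<beta> ^ n) =
          gap n * slope n / \<beta> ^ n * \<alpha> + gap n * off n / (2 * \<beta> ^ n)"
        using \<open>\<beta> > 1\<close> by (simp add: field_simps)
    qed simp
    also have "\<dots> = (\<Sum>n<m. gap n * slope n / \<beta> ^ n) * \<alpha> + (\<Sum>n<m. gap n * off n / (2 * \<beta> ^ n))"
      by (simp add: sum.distrib sum_distrib_right)
    finally have first: "(LINT x:{0..1}|lborel. x * g_tilde \<beta> \<alpha> x) = \<dots>" .
    have "M \<beta> \<alpha> = (LINT x:{0..1}|lborel. x * g_tilde \<beta> \<alpha> x) / mass"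
      unfolding M_def g_def mass by (simp add: set_lebesgue_integral_def)
    then show ?thesis
      unfolding first c_def d_def by (simp add: add_divide_distrib)
  qed
  then show ?thesis by blast
qed

end
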